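(* Let $(X,d)$ be a compact metric space and let $\mathbb{F}=\{f_n:n\in\mathbb{N}\}$ be a family of continuous surjective maps $f_n:X\to X$. Then $(X,\mathbb{F})$ is topologically mixing if and only if for each non-empty open set $U\subseteq X$, $\lim_{n\to\infty}\omega_n(U)=X$.
   Context: $\mathbb{N}$ denotes the positive integers. $(X,\mathbb{F})$ is the non-autonomous system $x_n=f_n(x_{n-1})$, and $\omega_n=f_n\circ f_{n-1}\circ\cdots\circ f_1$. The family $\mathbb{F}$ is an arbitrary sequence of maps (repetitions allowed). The system is topologically mixing if for every pair of non-empty open sets $U,V\subseteq X$ there exists $K\in\mathbb{N}$ such that $\omega_n(U)\cap V\neq\emptyset$ for all $n\ge K$. Limits of sets are taken in the Hausdorff metric: for non-empty $A,B\subseteq X$, $d_H(A,B)=\inf\{\epsilon>0: A\subseteq S_\epsilon(B)\text{ and }B\subseteq S_\epsilon(A)\}$, where $S_\epsilon(A)=\{x\in X: d(x,a)<\epsilon\text{ for some }a\in A\}$; $\lim_{n\to\infty}A_n=X$ means $d_H(A_n,X)\to0$. *)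

theory Defs
  imports "HOL-Analysis.Analysis"
begin

(* The maps are f 1, f 2, ...; the value f 0 is never used.
   omega f n = f n o ... o f 1 for n >= 1, and omega f 0 is the empty composition. *)
primrec omega :: "(nat \<Rightarrow> 'a \<Rightarrow> 'a) \<Rightarrow> nat \<Rightarrow> 'a \<Rightarrow> 'a" where
  "omega f 0 = id"
| "omega f (Suc n) = f (Suc n) \<circ> omega f n"

definition topologically_mixing :: "'a topology \<Rightarrow> (nat \<Rightarrow> 'a \<Rightarrow> 'a) \<Rightarrow> bool" where
  "topologically_mixing T f \<longleftrightarrow>
     (\<forall>U V. openin T U \<and> U \<noteq> {} \<and> openin T V \<and> V \<noteq> {} \<longrightarrow>
        (\<exists>K\<ge>1. \<forall>n\<ge>K. omega f n ` U \<inter> V \<noteq> {}))"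

context Metric_space
begin

definition set_nbhd :: "real \<Rightarrow> 'a set \<Rightarrow> 'a set" where
  "set_nbhd e A = {x \<in> M. \<exists>a\<in>A. d x a < e}"

(* The infimum is meaningful for non-empty bounded A, B (in particular, for all non-empty
   subsets of a compact space); otherwise the set may be empty and Inf is unspecified. *)
definition hausdorff_dist :: "'a set \<Rightarrow> 'a set \<Rightarrow> real" where
  "hausdorff_dist A B = Inf {e. e > 0 \<and> A \<subseteq> set_nbhd e B \<and> B \<subseteq> set_nbhd e A}"

definition hausdorff_limit :: "(nat \<Rightarrow> 'a set) \<Rightarrow> 'a set \<Rightarrow> bool" where
  "hausdorff_limit A L \<longleftrightarrow> (\<lambda>n. hausdorff_dist (A n) L) \<longlonglongrightarrow> 0"

end

end

theory Submission
  imports Defs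
begin

text \<open>
  Since \<open>\<omega>\<^sub>n(U) \<subseteq> X\<close>, the distance \<open>d\<^sub>H(\<omega>\<^sub>n(U), X)\<close> is below \<open>\<epsilon>\<close> iff \<open>\<omega>\<^sub>n(U)\<close> is
  \<open>\<delta>\<close>-dense for some \<open>\<delta> < \<epsilon>\<close>. Mixing against the finitely many balls of an \<open>\<epsilon>/2\<close>-net gives
  density of \<open>\<omega>\<^sub>n(U)\<close> for large \<open>n\<close>; conversely a dense enough set meets every ball inside \<open>V\<close>.
\<close>

lemma omega_in:
  assumes "\<And>n x. n \<ge> 1 \<Longrightarrow> x \<in> X \<Longrightarrow> f n x \<in> X" "x \<in> X"
  shows "omega f n x \<in> X"
  using assms by (induction n) auto

context Metric_space
begin

text \<open>As \<open>A\<close> lies in \<open>M\<close>, the inclusion of \<open>A\<close> in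
  \<open>set_nbhd e M\<close> holds for every positive \<open>e\<close>, so only the density of
  \<open>A\<close> constrains the infimum. Boundedness of \<open>M\<close> makes the set of
  admissible radii non-empty, so that \<open>Inf\<close> is a true infimum.\<close>

lemma hausdorff_dist_space:
  assumes "mbounded M" "A \<subseteq> M" "A \<noteq> {}"
  shows "hausdorff_dist A M \<ge> 0"
    and "hausdorff_dist A M < r \<longleftrightarrow> (\<exists>e. 0 < e \<and> e < r \<and> M \<subseteq> set_nbhd e A)"
proof -
  let ?E = "{e. e > 0 \<and> A \<subseteq> set_nbhd e M \<and> M \<subseteq> set_nbhd e A}"
  have E: "?E = {e. e > 0 \<and> M \<subseteq> set_nbhd e A}"
    using assms(2) by (force simp: set_nbhd_def)
  obtain a where a: "a \<in> A" "a \<in> M"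
    using assms by blast
  obtain B where B: "\<And>x y. x \<in> M \<Longrightarrow> y \<in> M \<Longrightarrow> d x y \<le> B"
    using assms(1) by (auto simp: mbounded_alt)
  have "B \<ge> 0"
    using B[of a a] a by simp
  moreover have "d x a < B + 1" if "x \<in> M" for x
    using B[OF that a(2)] by simp
  \<comment> \<open>Adding 1 to the diameter bound \<open>B\<close> gives a positive radius and the
    strict inequality that \<open>set_nbhd\<close> demands; the single point \<open>a\<close> then
    reaches all of \<open>M\<close>.\<close>
  ultimately have "B + 1 \<in> ?E"
    unfolding E using a by (auto simp: set_nbhd_def)
  then have ne: "?E \<noteq> {}"
    by blast
  show "hausdorff_dist A M \<ge> 0"
    unfolding hausdorff_dist_def by (rule cInf_greatest[OF ne]) auto
  have "bdd_below ?E"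
    by (rule bdd_belowI[of _ 0]) auto
  then show "hausdorff_dist A M < r \<longleftrightarrow> (\<exists>e. 0 < e \<and> e < r \<and> M \<subseteq> set_nbhd e A)"
    unfolding hausdorff_dist_def cInf_less_iff[OF ne \<open>bdd_below ?E\<close>] unfolding E by auto
qed

lemma hausdorff_limit_iff_dense:
  assumes "mbounded M" "\<And>n. A n \<subseteq> M" "\<And>n. A n \<noteq> {}"
  shows "hausdorff_limit A M \<longleftrightarrow> (\<forall>e>0. \<forall>\<^sub>F n in sequentially. M \<subseteq> set_nbhd e (A n))"
proof -
  note dist = hausdorff_dist_space[OF assms]
  have "hausdorff_limit A M \<longleftrightarrow> (\<forall>r>0. \<forall>\<^sub>F n in sequentially. hausdorff_dist (A n) M < r)"
    unfolding hausdorff_limit_def tendsto_iff using dist(1) by simp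
  also have "\<dots> \<longleftrightarrow> (\<forall>e>0. \<forall>\<^sub>F n in sequentially. M \<subseteq> set_nbhd e (A n))"
  proof (intro iffI allI impI)
    fix e :: real
    assume "\<forall>r>0. \<forall>\<^sub>F n in sequentially. hausdorff_dist (A n) M < r" "e > 0"
    then have "\<forall>\<^sub>F n in sequentially. hausdorff_dist (A n) M < e"
      by blast
    then show "\<forall>\<^sub>F n in sequentially. M \<subseteq> set_nbhd e (A n)"
    proof eventually_elim
      case (elim n)
      then obtain e' where "e' < e" "M \<subseteq> set_nbhd e' (A n)"
        using dist(2) by blast
      \<comment> \<open>Neighbourhoods grow with the radius.\<close>
      then show ?case
        unfolding set_nbhd_def by force
    qed
  next
    fix r :: real
    assume dense: "\<forall>e>0. \<forall>\<^sub>F n in sequentially. M \<subseteq> set_nbhd e (A n)" and "r > 0"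
    \<comment> \<open>Halving leaves room for the strict bound: an admissible radius strictly below
      \<open>r\<close> is required.\<close>
    then have "\<forall>\<^sub>F n in sequentially. M \<subseteq> set_nbhd (r / 2) (A n)"
      by simp
    then show "\<forall>\<^sub>F n in sequentially. hausdorff_dist (A n) M < r"
    proof eventually_elim
      case (elim n)
      then show ?case
        unfolding dist(2) using \<open>r > 0\<close> by (intro exI[of _ "r / 2"]) simp
    qed
  qed
  finally show ?thesis .
qed

text \<open>Total boundedness replaces the infinitely many points of \<open>M\<close> by finitely
  many balls, so that the thresholds for the single balls have a common bound.\<close>

lemma eventually_dense_iff_meets_open:
  assumes "mtotally_bounded M" "\<And>n. A n \<subseteq> M"
  shows "(\<forall>e>0. \<forall>\<^sub>F n in sequentially. M \<subseteq> set_nbhd e (A n)) \<longleftrightarrow>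
    (\<forall>V. openin mtopology V \<and> V \<noteq> {} \<longrightarrow> (\<forall>\<^sub>F n in sequentially. A n \<inter> V \<noteq> {}))"
proof (intro iffI allI impI)
  fix V
  assume dense: "\<forall>e>0. \<forall>\<^sub>F n in sequentially. M \<subseteq> set_nbhd e (A n)"
    and V: "openin mtopology V \<and> V \<noteq> {}"
  then obtain y r where y: "y \<in> M" and r: "r > 0" "mball y r \<subseteq> V"
    unfolding openin_mtopology by blast
  \<comment> \<open>Density is applied at the centre \<open>y\<close>: a point of \<open>A n\<close>
    closer than \<open>r\<close> to \<open>y\<close> lies in \<open>V\<close>.\<close>
  have "\<forall>\<^sub>F n in sequentially. M \<subseteq> set_nbhd r (A n)"
    using dense r by blast
  then show "\<forall>\<^sub>F n in sequentially. A n \<inter> V \<noteq> {}"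
  proof eventually_elim
    case (elim n)
    then obtain a where "a \<in> A n" "d y a < r"
      using y by (auto simp: set_nbhd_def)
    then have "a \<in> mball y r"
      using y assms(2) by auto
    then show ?case
      using \<open>a \<in> A n\<close> r by blast
  qed
next
  fix e :: real
  assume meets: "\<forall>V. openin mtopology V \<and> V \<noteq> {} \<longrightarrow> (\<forall>\<^sub>F n in sequentially. A n \<inter> V \<noteq> {})"
    and e: "e > 0"
  \<comment> \<open>With radius \<open>e / 2\<close>, any two points in one ball of the net are less
    than \<open>e\<close> apart.\<close>
  obtain K where K: "finite K" "K \<subseteq> M" "M \<subseteq> (\<Union>x\<in>K. mball x (e / 2))"
    using assms(1) e unfolding mtotally_bounded_def by (meson half_gt_zero)
  have "\<forall>\<^sub>F n in sequentially. A n \<inter> mball x (e / 2) \<noteq> {}" if "x \<in> K" for x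
  proof -
    have "mball x (e / 2) \<noteq> {}"
      using that K(2) e by (metis centre_in_mball_iff empty_iff half_gt_zero subsetD)
    then show ?thesis
      using meets by simp
  qed
  then have "\<forall>\<^sub>F n in sequentially. \<forall>x\<in>K. A n \<inter> mball x (e / 2) \<noteq> {}"
    using K(1) by (simp add: eventually_ball_finite)
  then show "\<forall>\<^sub>F n in sequentially. M \<subseteq> set_nbhd e (A n)"
  proof eventually_elim
    case (elim n)
    show ?case
    proof
      fix z
      assume z: "z \<in> M"
      then obtain x where x: "x \<in> K" "x \<in> M" "d x z < e / 2"
        using K by auto
      then obtain a where a: "a \<in> A n" "a \<in> M" "d x a < e / 2"
        using elim by fastforce
      have "d z a \<le> d x z + d x a"
        using triangle[of z x a] x z a commute by simp
      then show "z \<in> set_nbhd e (A n)"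
        unfolding set_nbhd_def using x a z by force
    qed
  qed
qed

end

lemma topologically_mixing_iff_eventually:
  "topologically_mixing T f \<longleftrightarrow>
    (\<forall>U. openin T U \<and> U \<noteq> {} \<longrightarrow>
      (\<forall>V. openin T V \<and> V \<noteq> {} \<longrightarrow> (\<forall>\<^sub>F n in sequentially. omega f n ` U \<inter> V \<noteq> {})))"
proof -
  have "(\<exists>K\<ge>1. \<forall>n\<ge>K. P n) \<longleftrightarrow> (\<forall>\<^sub>F n in sequentially. P n)" for P :: "nat \<Rightarrow> bool"
    unfolding eventually_sequentially
  proof
    assume "\<exists>N. \<forall>n\<ge>N. P n"
    then obtain N where "\<forall>n\<ge>N. P n"
      by blast
    \<comment> \<open>Raising the threshold to at least 1 keeps it valid.\<close>
    then show "\<exists>K\<ge>1. \<forall>n\<ge>K. P n"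
      by (intro exI[of _ "max 1 N"]) simp
  qed blast
  then show ?thesis
    unfolding topologically_mixing_def by (simp only:) blast
qed

theorem lemma8:
  fixes X :: "'a set" and d :: "'a \<Rightarrow> 'a \<Rightarrow> real" and f :: "nat \<Rightarrow> 'a \<Rightarrow> 'a"
  assumes "Metric_space X d"
    and "compact_space (Metric_space.mtopology X d)"
    and "\<And>n. n \<ge> 1 \<Longrightarrow>
           continuous_map (Metric_space.mtopology X d) (Metric_space.mtopology X d) (f n)"
    and "\<And>n. n \<ge> 1 \<Longrightarrow> f n ` X = X"
  shows "topologically_mixing (Metric_space.mtopology X d) f \<longleftrightarrow>
         (\<forall>U. openin (Metric_space.mtopology X d) U \<and> U \<noteq> {} \<longrightarrow>
            Metric_space.hausdorff_limit X d (\<lambda>n. omega f n ` U) X)"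
proof -
  interpret Metric_space X d
    by fact
  have "compactin mtopology X"
    using assms(2) by (simp add: compact_space_def)
  then have bounded: "mbounded X" and tb: "mtotally_bounded X"
    by (simp_all add: compactin_imp_mbounded compactin_imp_mtotally_bounded)
  have limit_iff: "hausdorff_limit (\<lambda>n. omega f n ` U) X \<longleftrightarrow>
      (\<forall>V. openin mtopology V \<and> V \<noteq> {} \<longrightarrow> (\<forall>\<^sub>F n in sequentially. omega f n ` U \<inter> V \<noteq> {}))"
    if U: "openin mtopology U" "U \<noteq> {}" for U
  proof -
    \<comment> \<open>Surjectivity, as \<open>f n\<close> maps \<open>X\<close> onto
      \<open>X\<close>, also says that \<open>X\<close> is invariant.\<close>
    have sub: "omega f n ` U \<subseteq> X" for n
      using omega_in[of X f] assms(4) openin_subset[OF U(1)] by fastforce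
    show ?thesis
      using hausdorff_limit_iff_dense[OF bounded sub] eventually_dense_iff_meets_open[OF tb sub] U(2)
      by simp
  qed
  then show ?thesis
    unfolding topologically_mixing_iff_eventually by blast
qed

end
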